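(* Let $(\mathcal R,\exp)$ be an exponential field which is o-minimal (as a structure in the language $(+,\cdot,0,1,\leqslant,\exp)$) and satisfies $\exp(1)=2$. Let $\mathcal M\subseteq\mathcal R$ be a discretely ordered ring such that $(\mathcal M,\exp)$ is an exponential integer part of $(\mathcal R,\exp)$. Then $(\mathcal M^+,\exp|_{M^+})$, with $S(x)$ interpreted as $x+1$, is a model of $\mathsf{IOpen}(\exp)$.
   Context: An exponential field is an ordered field $\mathcal F$ together with a map $\exp\colon F\to F^{>0}$ which is an order-preserving isomorphism from $(F,+)$ onto $(F^{>0},\cdot)$. A structure with a dense linear order is o-minimal if every definable (with parameters) subset of its domain is a finite union of intervals and points. A discretely ordered ring is an ordered (commutative unital) ring in which $1$ is the least positive element; $M^+=\{m\in M:m\geqslant 0\}$. If $\mathcal M\subseteq\mathcal R$ with $\mathcal M$ discretely ordered, $\mathcal M$ is an integer part of $\mathcal R$ if for every $r\in R$ there is $m\in M$ with $m\leqslant r<m+1$; $(\mathcal M,\exp)$ is an exponential integer part of $(\mathcal R,\exp)$ if moreover $\exp(m)\in M^+$ for all $m\in M^+$. The theory $\mathsf{IOpen}(\exp)$ in the language $(0,S,+,\cdot,\leqslant,\exp)$ consists of: (Q1) $Sx\neq 0$; (Q2) $Sx=Sy\to x=y$; (Q3) $x\neq 0\to\exists y\,(x=Sy)$; (Q4) $x+0=x$; (Q5) $x+Sy=S(x+y)$; (Q6) $x\cdot 0=0$; (Q7) $x\cdot Sy=x\cdot y+x$; (Q8) $x\leqslant y\leftrightarrow\exists r\,(r+x=y)$;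 (E1) $\exp(0)=S(0)$; (E2) $\exp(S(x))=\exp(x)+\exp(x)$; and the induction scheme $\big(\varphi(0,\bar y)\wedge\forall x(\varphi(x,\bar y)\to\varphi(S(x),\bar y))\big)\to\forall x\,\varphi(x,\bar y)$ for every quantifier-free formula $\varphi$ of this language. *)

theory Defs
  imports Main
begin

text \<open>
  First-order formulas with equality and one binary relation symbol; the terms (and so the
  function symbols of the language) are a parameter. Variables are named by natural numbers.
\<close>

datatype 't fm =
    Equal 't 't
  | Leq 't 't
  | Neg "'t fm"
  | Conj "'t fm" "'t fm"
  | Disj "'t fm" "'t fm"
  | Impl "'t fm" "'t fm"
  | Forall nat "'t fm"
  | Exists nat "'t fm"

abbreviation Iff :: "'t fm \<Rightarrow> 't fm \<Rightarrow> 't fm" where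
  "Iff p q \<equiv> Conj (Impl p q) (Impl q p)"

fun sat :: "'a set \<Rightarrow> ('a \<Rightarrow> 'a \<Rightarrow> bool) \<Rightarrow> ((nat \<Rightarrow> 'a) \<Rightarrow> 't \<Rightarrow> 'a)
    \<Rightarrow> (nat \<Rightarrow> 'a) \<Rightarrow> 't fm \<Rightarrow> bool" where
  "sat D le val v (Equal s t) \<longleftrightarrow> val v s = val v t"
| "sat D le val v (Leq s t) \<longleftrightarrow> le (val v s) (val v t)"
| "sat D le val v (Neg p) \<longleftrightarrow> \<not> sat D le val v p"
| "sat D le val v (Conj p q) \<longleftrightarrow> sat D le val v p \<and> sat D le val v q"
| "sat D le val v (Disj p q) \<longleftrightarrow> sat D le val v p \<or> sat D le val v q"
| "sat D le val v (Impl p q) \<longleftrightarrow> (sat D le val v p \<longrightarrow> sat D le val v q)"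
| "sat D le val v (Forall x p) \<longleftrightarrow> (\<forall>a\<in>D. sat D le val (v(x := a)) p)"
| "sat D le val v (Exists x p) \<longleftrightarrow> (\<exists>a\<in>D. sat D le val (v(x := a)) p)"

fun quantifier_free :: "'t fm \<Rightarrow> bool" where
  "quantifier_free (Equal s t) \<longleftrightarrow> True"
| "quantifier_free (Leq s t) \<longleftrightarrow> True"
| "quantifier_free (Neg p) \<longleftrightarrow> quantifier_free p"
| "quantifier_free (Conj p q) \<longleftrightarrow> quantifier_free p \<and> quantifier_free q"
| "quantifier_free (Disj p q) \<longleftrightarrow> quantifier_free p \<and> quantifier_free q"
| "quantifier_free (Impl p q) \<longleftrightarrow> quantifier_free p \<and> quantifier_free q"
| "quantifier_free (Forall x p) \<longleftrightarrow> False"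
| "quantifier_free (Exists x p) \<longleftrightarrow> False"


section \<open>O-minimal exponential fields\<close>

text \<open>
  The type \<open>'a\<close> is the domain of the structure. In \<open>definable\<close>, variable \<open>0\<close> is the free variable
  of the formula and the rest of the assignment \<open>v\<close> supplies the parameters.
\<close>

definition definable :: "((nat \<Rightarrow> 'a::order) \<Rightarrow> 't \<Rightarrow> 'a) \<Rightarrow> 'a set \<Rightarrow> bool" where
  "definable val X \<longleftrightarrow> (\<exists>p v. X = {a. sat UNIV (\<le>) val (v(0 := a)) p})"

text \<open>
  Intervals have endpoints in the structure or at infinity; an arbitrary convex set does not count.
  Half-open and closed intervals are unions of an open interval and points.
\<close>

definition open_interval :: "'a::linorder set \<Rightarrow> bool" where
  "open_interval X \<longleftrightarrow> X = UNIV \<or> (\<exists>a. X = {a<..}) \<or> (\<exists>b. X = {..<b}) \<or> (\<exists>a b. X = {a<..<b})"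

definition o_minimal :: "((nat \<Rightarrow> 'a::dense_linorder) \<Rightarrow> 't \<Rightarrow> 'a) \<Rightarrow> bool" where
  "o_minimal val \<longleftrightarrow> (\<forall>X. definable val X \<longrightarrow>
     (\<exists>\<C>. finite \<C> \<and> (\<forall>I\<in>\<C>. open_interval I \<or> (\<exists>a. I = {a})) \<and> X = \<Union>\<C>))"

datatype field_term =
    FVar nat
  | FZero
  | FOne
  | FAdd field_term field_term
  | FMul field_term field_term
  | FExp field_term

fun field_val :: "('a::linordered_field \<Rightarrow> 'a) \<Rightarrow> (nat \<Rightarrow> 'a) \<Rightarrow> field_term \<Rightarrow> 'a" where
  "field_val e v (FVar x) = v x"
| "field_val e v FZero = 0"
| "field_val e v FOne = 1"
| "field_val e v (FAdd s t) = field_val e v s + field_val e v t"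
| "field_val e v (FMul s t) = field_val e v s * field_val e v t"
| "field_val e v (FExp s) = e (field_val e v s)"

definition exponential_field :: "('a::linordered_field \<Rightarrow> 'a) \<Rightarrow> bool" where
  "exponential_field e \<longleftrightarrow>
     bij_betw e UNIV {0<..} \<and>
     (\<forall>x y. e (x + y) = e x * e y) \<and>
     (\<forall>x y. x \<le> y \<longleftrightarrow> e x \<le> e y)"


section \<open>Exponential integer parts\<close>

definition discretely_ordered_subring :: "'a::linordered_field set \<Rightarrow> bool" where
  "discretely_ordered_subring M \<longleftrightarrow>
     0 \<in> M \<and> 1 \<in> M \<and>
     (\<forall>x\<in>M. \<forall>y\<in>M. x + y \<in> M) \<and>
     (\<forall>x\<in>M. - x \<in> M) \<and>
     (\<forall>x\<in>M. \<forall>y\<in>M. x * y \<in> M) \<and>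
     (\<forall>x\<in>M. 0 < x \<longrightarrow> 1 \<le> x)"

definition nonneg_part :: "'a::linordered_field set \<Rightarrow> 'a set" where
  "nonneg_part M = {m \<in> M. 0 \<le> m}"

definition integer_part :: "'a::linordered_field set \<Rightarrow> bool" where
  "integer_part M \<longleftrightarrow>
     discretely_ordered_subring M \<and> (\<forall>r. \<exists>m\<in>M. m \<le> r \<and> r < m + 1)"

definition exponential_integer_part :: "('a::linordered_field \<Rightarrow> 'a) \<Rightarrow> 'a set \<Rightarrow> bool" where
  "exponential_integer_part e M \<longleftrightarrow>
     integer_part M \<and> (\<forall>m\<in>nonneg_part M. e m \<in> nonneg_part M)"


section \<open>The theory IOpen(exp)\<close>

datatype arith_term =
    AVar nat
  | AZero
  | ASuc arith_term
  | AAdd arith_term arith_term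
  | AMul arith_term arith_term
  | AExp arith_term

text \<open>
  The operations are total on \<open>'a\<close>, but only their restriction to the universe matters:
  \<open>arith_structure\<close> demands closure, and assignments and quantifiers range over the universe.
\<close>

record 'a arith_struct =
  universe :: "'a set"
  zero_of :: 'a
  suc_of :: "'a \<Rightarrow> 'a"
  add_of :: "'a \<Rightarrow> 'a \<Rightarrow> 'a"
  mul_of :: "'a \<Rightarrow> 'a \<Rightarrow> 'a"
  leq_of :: "'a \<Rightarrow> 'a \<Rightarrow> bool"
  exp_of :: "'a \<Rightarrow> 'a"

definition arith_structure :: "'a arith_struct \<Rightarrow> bool" where
  "arith_structure A \<longleftrightarrow>
     zero_of A \<in> universe A \<and>
     (\<forall>x\<in>universe A. suc_of A x \<in> universe A) \<and>
     (\<forall>x\<in>universe A. \<forall>y\<in>universe A. add_of A x y \<in> universe A) \<and>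
     (\<forall>x\<in>universe A. \<forall>y\<in>universe A. mul_of A x y \<in> universe A) \<and>
     (\<forall>x\<in>universe A. exp_of A x \<in> universe A)"

fun arith_val :: "'a arith_struct \<Rightarrow> (nat \<Rightarrow> 'a) \<Rightarrow> arith_term \<Rightarrow> 'a" where
  "arith_val A v (AVar x) = v x"
| "arith_val A v AZero = zero_of A"
| "arith_val A v (ASuc s) = suc_of A (arith_val A v s)"
| "arith_val A v (AAdd s t) = add_of A (arith_val A v s) (arith_val A v t)"
| "arith_val A v (AMul s t) = mul_of A (arith_val A v s) (arith_val A v t)"
| "arith_val A v (AExp s) = exp_of A (arith_val A v s)"

text \<open>Validity under all assignments into the universe, i.e. truth of the universal closure.\<close>

definition arith_model :: "'a arith_struct \<Rightarrow> arith_term fm set \<Rightarrow> bool" where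
  "arith_model A T \<longleftrightarrow> arith_structure A \<and>
     (\<forall>p\<in>T. \<forall>v. range v \<subseteq> universe A \<longrightarrow> sat (universe A) (leq_of A) (arith_val A) v p)"

fun subst_term :: "nat \<Rightarrow> arith_term \<Rightarrow> arith_term \<Rightarrow> arith_term" where
  "subst_term x u (AVar y) = (if y = x then u else AVar y)"
| "subst_term x u AZero = AZero"
| "subst_term x u (ASuc s) = ASuc (subst_term x u s)"
| "subst_term x u (AAdd s t) = AAdd (subst_term x u s) (subst_term x u t)"
| "subst_term x u (AMul s t) = AMul (subst_term x u s) (subst_term x u t)"
| "subst_term x u (AExp s) = AExp (subst_term x u s)"

text \<open>
  Substituting in every term of a formula is the correct substitution only for quantifier-free
  formulas, the only ones for which it is used below.
\<close>

abbreviation subst_qf :: "nat \<Rightarrow> arith_term \<Rightarrow> arith_term fm \<Rightarrow> arith_term fm" where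
  "subst_qf x u p \<equiv> map_fm (subst_term x u) p"

text \<open>The variables of \<open>p\<close> other than \<open>x\<close> are the parameters of the induction.\<close>

definition induction_axiom :: "nat \<Rightarrow> arith_term fm \<Rightarrow> arith_term fm" where
  "induction_axiom x p =
     Impl (Conj (subst_qf x AZero p) (Forall x (Impl p (subst_qf x (ASuc (AVar x)) p))))
          (Forall x p)"

definition IOpen_exp :: "arith_term fm set" where
  "IOpen_exp =
     (let x = AVar 0; y = AVar 1; r = AVar 2 in
      { Neg (Equal (ASuc x) AZero),
        Impl (Equal (ASuc x) (ASuc y)) (Equal x y),
        Impl (Neg (Equal x AZero)) (Exists 1 (Equal x (ASuc y))),
        Equal (AAdd x AZero) x,
        Equal (AAdd x (ASuc y)) (ASuc (AAdd x y)),
        Equal (AMul x AZero) AZero,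
        Equal (AMul x (ASuc y)) (AAdd (AMul x y) x),
        Iff (Leq x y) (Exists 2 (Equal (AAdd r x) y)),
        Equal (AExp AZero) (ASuc AZero),
        Equal (AExp (ASuc x)) (AAdd (AExp x) (AExp x)) })
     \<union> {induction_axiom x p | x p. quantifier_free p}"

definition nonneg_structure ::
    "('a::linordered_field \<Rightarrow> 'a) \<Rightarrow> 'a set \<Rightarrow> 'a arith_struct" where
  "nonneg_structure e M =
     \<lparr> universe = nonneg_part M,
       zero_of = 0,
       suc_of = (\<lambda>x. x + 1),
       add_of = (+),
       mul_of = (*),
       leq_of = (\<le>),
       exp_of = e \<rparr>"

end

theory Submission imports Defs begin

text \<open>
  If induction failed for a quantifier-free formula, the formula would have a counterexample
  in \<open>M\<^sup>+\<close>. The set of all its counterexamples in the field is definable, hence a finite union of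
  intervals and points. Since \<open>M\<close> is an integer part, every interval that meets \<open>M\<^sup>+\<close> has a least
  element of \<open>M\<^sup>+\<close>: either \<open>0\<close> or the successor of the integer part of its left endpoint. So there
  is a least counterexample in \<open>M\<^sup>+\<close>, which contradicts the induction hypothesis.
\<close>

text \<open>Without quantifiers the universe is never consulted, so \<open>D\<close> and
  \<open>D'\<close> may differ. This covers both substitution inside \<open>M\<close> and the
  passage from \<open>M\<^sup>+\<close> to the whole field.\<close>

lemma sat_map_fm_quantifier_free:
  assumes "quantifier_free p" and "\<And>t. val' v' (f t) = val v t"
  shows "sat D' le val' v' (map_fm f p) \<longleftrightarrow> sat D le val v p"
  using assms(1) by (induction p) (simp_all add: assms(2))

lemma arith_val_subst_term:
  "arith_val A v (subst_term x u t) = arith_val A (v(x := arith_val A v u)) t"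
  by (induction t) auto

lemma sat_subst_qf:
  assumes "quantifier_free p"
  shows "sat D le (arith_val A) v (subst_qf x u p)
    \<longleftrightarrow> sat D le (arith_val A) (v(x := arith_val A v u)) p"
  using assms by (rule sat_map_fm_quantifier_free) (rule arith_val_subst_term)

text \<open>The renaming \<open>g\<close> is built in because \<open>definable\<close> reserves
  variable 0, while induction may run over any variable.\<close>

fun field_term_of :: "(nat \<Rightarrow> nat) \<Rightarrow> arith_term \<Rightarrow> field_term" where
  "field_term_of g (AVar y) = FVar (g y)"
| "field_term_of g AZero = FZero"
| "field_term_of g (ASuc s) = FAdd (field_term_of g s) FOne"
| "field_term_of g (AAdd s t) = FAdd (field_term_of g s) (field_term_of g t)"
| "field_term_of g (AMul s t) = FMul (field_term_of g s) (field_term_of g t)"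
| "field_term_of g (AExp s) = FExp (field_term_of g s)"

lemma field_val_field_term_of:
  "field_val e v (field_term_of g t) = arith_val (nonneg_structure e M) (v \<circ> g) t"
  by (induction t) (simp_all add: nonneg_structure_def)

lemma definable_quantifier_free:
  assumes "quantifier_free p"
  shows "definable (field_val e)
    {a. sat D (\<le>) (arith_val (nonneg_structure e M)) (v(x := a)) p}"
proof -
  \<comment> \<open>Renames \<open>x\<close> to \<open>0\<close>, the variable that \<open>definable\<close> leaves free.\<close>
  define g where "g y = (if y = x then 0 else Suc y)" for y
  \<comment> \<open>\<open>w\<close> undoes the shift that \<open>g\<close> applies to the
    parameters; its value at 0 is always overwritten by \<open>a\<close>.\<close>
  define w where "w = (\<lambda>n. v (n - 1))"
  have "w(0 := a) \<circ> g = v(x := a)" for a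
    by (auto simp: w_def g_def)
  then have "field_val e (w(0 := a)) (field_term_of g t)
      = arith_val (nonneg_structure e M) (v(x := a)) t" for a t
    by (simp add: field_val_field_term_of[where M = M])
  then have "sat UNIV (\<le>) (field_val e) (w(0 := a)) (map_fm (field_term_of g) p)
      \<longleftrightarrow> sat D (\<le>) (arith_val (nonneg_structure e M)) (v(x := a)) p" for a
    using assms by (intro sat_map_fm_quantifier_free)
  then show ?thesis
    unfolding definable_def by blast
qed

lemma discretely_ordered_subring_diff:
  assumes "discretely_ordered_subring M" "x \<in> M" "y \<in> M"
  shows "x - y \<in> M"
  using assms unfolding discretely_ordered_subring_def by (metis diff_conv_add_uminus)

lemma discretely_ordered_subring_add_one_le:
  assumes "discretely_ordered_subring M" "x \<in> M" "y \<in> M" "x < y"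
  shows "x + 1 \<le> y"
proof -
  have "y - x \<in> M" "0 < y - x"
    using discretely_ordered_subring_diff assms by auto
  then have "1 \<le> y - x"
    using assms(1) by (auto simp: discretely_ordered_subring_def)
  then show ?thesis by (simp add: algebra_simps)
qed

lemma integer_part_least_above:
  assumes M: "integer_part M"
  shows "\<exists>k\<in>nonneg_part M. a < k \<and> (\<forall>m\<in>nonneg_part M. a < m \<longrightarrow> k \<le> m)"
proof (cases "a < 0")
  case True
  with M show ?thesis
    by (intro bexI[of _ 0])
      (auto simp: integer_part_def discretely_ordered_subring_def nonneg_part_def)
next
  case False
  from M have D: "discretely_ordered_subring M"
    by (simp add: integer_part_def)
  from M obtain n where n: "n \<in> M" "n \<le> a" "a < n + 1"
    unfolding integer_part_def by blast
  show ?thesis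
  proof (intro bexI[of _ "n + 1"] conjI ballI impI)
    show "n + 1 \<in> nonneg_part M"
      using D n False by (auto simp: discretely_ordered_subring_def nonneg_part_def)
    show "a < n + 1" by (fact n)
    \<comment> \<open>Here \<open>n \<le> a < m\<close> with \<open>n\<close> and \<open>m\<close>
      both in \<open>M\<close>, so discreteness leaves no room for \<open>m\<close> below
      \<open>n + 1\<close>.\<close>
    show "n + 1 \<le> m" if "m \<in> nonneg_part M" "a < m" for m
      using that n discretely_ordered_subring_add_one_le[OF D]
      by (auto simp: nonneg_part_def)
  qed
qed

lemma interval_least_element:
  assumes M: "integer_part M"
    and I: "open_interval I \<or> (\<exists>a. I = {a})"
    and ne: "I \<inter> nonneg_part M \<noteq> {}"
  shows "\<exists>k\<in>I \<inter> nonneg_part M. \<forall>m\<in>I \<inter> nonneg_part M. k \<le> m"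
proof -
  \<comment> \<open>The downward closed case covers the whole line and the rays
    \<open>{..<b}\<close>; such a set contains 0 as soon as it meets
    \<open>M\<^sup>+\<close>.\<close>
  consider "\<And>x y. x \<in> I \<Longrightarrow> y \<le> x \<Longrightarrow> y \<in> I" | a b where "I = {a<..} \<or> I = {a<..<b}" | a where "I = {a}"
    using I unfolding open_interval_def by fastforce
  then show ?thesis
  proof cases
    case 1
    with ne M have "0 \<in> I \<inter> nonneg_part M"
      by (auto simp: nonneg_part_def integer_part_def discretely_ordered_subring_def)
    then show ?thesis by (auto simp: nonneg_part_def)
  next
    case (2 a b)
    obtain k where k: "k \<in> nonneg_part M" "a < k" "\<And>m. m \<in> nonneg_part M \<Longrightarrow> a < m \<Longrightarrow> k \<le> m"
      using integer_part_least_above[OF M, of a] by blast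
    obtain x where x: "x \<in> I" "x \<in> nonneg_part M"
      using ne by blast
    \<comment> \<open>The point \<open>x\<close> keeps \<open>k\<close> below the right endpoint, if
      there is one.\<close>
    with 2 k(3)[of x] have "k \<le> x" by auto
    with 2 k(2) x(1) have "k \<in> I" by auto
    moreover have "k \<le> m" if "m \<in> I \<inter> nonneg_part M" for m
      using that 2 k(3)[of m] by auto
    ultimately show ?thesis using k(1) by blast
  next
    case 3
    with ne show ?thesis by auto
  qed
qed

lemma o_minimal_least_element:
  assumes "o_minimal val" "definable val X"
    and M: "integer_part M"
    and ne: "X \<inter> nonneg_part M \<noteq> {}"
  shows "\<exists>k\<in>X \<inter> nonneg_part M. \<forall>m\<in>X \<inter> nonneg_part M. k \<le> m"
proof -
  obtain \<C> where C: "finite \<C>" "\<And>I. I \<in> \<C> \<Longrightarrow> open_interval I \<or> (\<exists>a. I = {a})" "X = \<Union>\<C>"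
    using assms(1,2) unfolding o_minimal_def by meson
  \<comment> \<open>Pieces missing \<open>M\<^sup>+\<close> have no least element to offer. The
    minimum over the finitely many others is the answer.\<close>
  define \<D> where "\<D> = {I \<in> \<C>. I \<inter> nonneg_part M \<noteq> {}}"
  have "\<forall>I\<in>\<D>. \<exists>k\<in>I \<inter> nonneg_part M. \<forall>m\<in>I \<inter> nonneg_part M. k \<le> m"
    using interval_least_element[OF M] C(2) unfolding \<D>_def by blast
  then obtain l where l: "\<And>I. I \<in> \<D> \<Longrightarrow> l I \<in> I \<inter> nonneg_part M"
      "\<And>I m. I \<in> \<D> \<Longrightarrow> m \<in> I \<inter> nonneg_part M \<Longrightarrow> l I \<le> m"
    by metis
  have fin: "finite (l ` \<D>)" and "l ` \<D> \<noteq> {}"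
    using C ne by (auto simp: \<D>_def)
  then have "Min (l ` \<D>) \<in> l ` \<D>"
    by (rule Min_in)
  then obtain I where "I \<in> \<D>" and I: "Min (l ` \<D>) = l I"
    by blast
  then have "Min (l ` \<D>) \<in> X \<inter> nonneg_part M"
    using l(1)[of I] C(3) unfolding I by (auto simp: \<D>_def)
  moreover have "Min (l ` \<D>) \<le> m" if "m \<in> X \<inter> nonneg_part M" for m
  proof -
    from that obtain I where "I \<in> \<D>" "m \<in> I \<inter> nonneg_part M"
      using C(3) by (auto simp: \<D>_def)
    then show ?thesis
      using l(2) fin by (meson Min_le imageI order_trans)
  qed
  ultimately show ?thesis by blast
qed

lemma nonneg_part_predecessor:
  assumes "discretely_ordered_subring M" "x \<in> nonneg_part M" "x \<noteq> 0"
  shows "x - 1 \<in> nonneg_part M"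
  using assms discretely_ordered_subring_diff[of M x 1]
  by (auto simp: nonneg_part_def discretely_ordered_subring_def)

lemma sat_induction_axiom:
  assumes "o_minimal (field_val e)" "integer_part M" "quantifier_free p"
  shows "sat (nonneg_part M) (\<le>) (arith_val (nonneg_structure e M)) v (induction_axiom x p)"
proof -
  let ?P = "\<lambda>a. sat (nonneg_part M) (\<le>) (arith_val (nonneg_structure e M)) (v(x := a)) p"
  let ?X = "{a. \<not> ?P a}"
  from assms(2) have D: "discretely_ordered_subring M"
    by (simp add: integer_part_def)
  have "\<forall>a\<in>nonneg_part M. ?P a"
    if zero: "?P 0" and step: "\<And>a. a \<in> nonneg_part M \<Longrightarrow> ?P a \<Longrightarrow> ?P (a + 1)"
  proof (rule ccontr)
    assume "\<not> ?thesis"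
    then have ne: "?X \<inter> nonneg_part M \<noteq> {}" by blast
    \<comment> \<open>\<open>?X\<close> collects counterexamples in the whole field, as o-minimality
      speaks only of subsets of the field definable there.\<close>
    have "definable (field_val e) ?X"
      using definable_quantifier_free[of "Neg p"] assms(3) by fastforce
    then obtain k where k: "k \<in> ?X \<inter> nonneg_part M" "\<forall>m\<in>?X \<inter> nonneg_part M. k \<le> m"
      using o_minimal_least_element[OF assms(1) _ assms(2) ne] by blast
    from k(1) zero have "k \<noteq> 0" by auto
    then have "k - 1 \<in> nonneg_part M"
      using nonneg_part_predecessor[OF D] k(1) by blast
    moreover have "\<not> k \<le> k - 1" by simp
    ultimately have "?P (k - 1)" using k(2) by blast
    with step[OF \<open>k - 1 \<in> nonneg_part M\<close>] k(1) show False by simp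
  qed
  then show ?thesis
    using assms(3) by (auto simp: induction_axiom_def sat_subst_qf nonneg_structure_def)
qed

lemma exponential_field_zero:
  assumes "exponential_field e"
  shows "e 0 = 1"
proof -
  have "e 0 = e 0 * e 0"
    using assms unfolding exponential_field_def by (metis add_0)
  moreover have "e 0 > 0"
    using assms unfolding exponential_field_def bij_betw_def by blast
  ultimately show ?thesis by simp
qed

theorem theorem2p2:
  fixes e :: "'a::linordered_field \<Rightarrow> 'a" and M :: "'a set"
  assumes "exponential_field e"
    and "o_minimal (field_val e)"
    and "e 1 = 2"
    and "discretely_ordered_subring M"
    and "exponential_integer_part e M"
  shows "arith_model (nonneg_structure e M) IOpen_exp"
proof -
  let ?A = "nonneg_structure e M"
  let ?N = "nonneg_part M"
  have IP: "integer_part M" and exp_closed: "\<And>m. m \<in> ?N \<Longrightarrow> e m \<in> ?N"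
    using assms(5) by (auto simp: exponential_integer_part_def)
  have "arith_structure ?A"
    using assms(4) exp_closed
    by (auto simp: arith_structure_def nonneg_structure_def nonneg_part_def
        discretely_ordered_subring_def)
  moreover have "sat ?N (\<le>) (arith_val ?A) v p"
    if p: "p \<in> IOpen_exp" and v: "range v \<subseteq> ?N" for p v
  \<comment> \<open>Splitting off the induction scheme leaves finitely many explicit axioms.\<close>
  proof (cases "\<exists>x q. p = induction_axiom x q \<and> quantifier_free q")
    case True
    then show ?thesis
      using sat_induction_axiom[OF assms(2) IP] by blast
  next
    case False
    have N: "v n \<in> ?N" "0 \<le> v n" for n
      using v by (auto simp: nonneg_part_def)
    \<comment> \<open>Additivity gives \<open>e a * e 1\<close>, and \<open>e 1 = 2\<close> turns
      this into doubling.\<close>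
    have e_suc: "e (a + 1) = e a + e a" for a
      using assms(1,3) by (simp add: exponential_field_def)
    have nonzero: "v n + 1 \<noteq> 0" for n
      using N(2)[of n] by linarith
    have pred: "\<exists>b\<in>?N. v n = b + 1" if "v n \<noteq> 0" for n
      using nonneg_part_predecessor[OF assms(4) N(1) that] by (intro bexI[of _ "v n - 1"]) auto
    have le_iff: "v m \<le> v n \<longleftrightarrow> (\<exists>r\<in>?N. r + v m = v n)" for m n
    proof
      assume "v m \<le> v n"
      then have "v n - v m \<in> ?N"
        using discretely_ordered_subring_diff[OF assms(4)] N by (auto simp: nonneg_part_def)
      then show "\<exists>r\<in>?N. r + v m = v n"
        by (intro bexI[of _ "v n - v m"]) auto
    next
      assume "\<exists>r\<in>?N. r + v m = v n"
      then obtain r where "0 \<le> r" "r + v m = v n"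
        by (auto simp: nonneg_part_def)
      then show "v m \<le> v n" by linarith
    qed
    \<comment> \<open>\<open>nonzero\<close>, \<open>pred\<close> and \<open>le_iff\<close> settle
      the axioms on successors of 0, predecessors and order; \<open>e_suc\<close> and
      \<open>e 0 = 1\<close> those on exp. The others are ring arithmetic.\<close>
    from p False show ?thesis
      unfolding IOpen_exp_def Let_def
      by (auto simp: nonneg_structure_def nonzero pred le_iff[symmetric] e_suc
          exponential_field_zero[OF assms(1)] add.assoc distrib_left)
  qed
  ultimately show ?thesis
    by (simp add: arith_model_def nonneg_structure_def)
qed

end
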